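(* Let $X\sim E_{1}(\mu,\sigma^{2},g_{1})$ be an elliptical random variable, $\sigma>0$, and suppose $$\int_{0}^{\infty}s^{-1/2}g_{1}(s)\,ds<\infty,\qquad \int_{0}^{\infty}s^{-1/2}\overline{G}_{1}(s)\,ds<\infty,\qquad \int_{0}^{\infty}s^{-1/2}\overline{\mathcal{G}}_{1}(s)\,ds<\infty .$$ Let $p,q\in(0,1)$ with $p<q$. Then $$\mathrm{RV}_{(p,q)}(X)=\frac{\sigma^{2}}{F_{Y}(\eta_{p},\eta_{q})}\left\{\lambda_{p,q}+\frac{c_{1}}{c_{1}^{*}}F_{Y^{*}}(\eta_{p},\eta_{q})-\frac{\delta_{p,q}^{2}}{F_{Y}(\eta_{p},\eta_{q})}\right\},$$ where $$\lambda_{p,q}=c_{1}\left[\eta_{p}\overline{G}_{1}\left(\tfrac12\eta_{p}^{2}\right)-\eta_{q}\overline{G}_{1}\left(\tfrac12\eta_{q}^{2}\right)\right],\qquad \delta_{p,q}=c_{1}\left[\overline{G}_{1}\left(\tfrac12\eta_{p}^{2}\right)-\overline{G}_{1}\left(\tfrac12\eta_{q}^{2}\right)\right],$$ $\eta_{v}=(\mathrm{VaR}_{v}(X)-\mu)/\sigma$ for $v\in\{p,q\}$, $Y\sim E_{1}(0,1,g_{1})$ and $Y^{*}\sim E_{1}(0,1,\overline{G}_{1})$.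
   Context: $\mathrm{VaR}_{p}(X)=\inf\{x: P(X\le x)\ge p\}$. For $0<p<q<1$, $\mathrm{RVaR}_{(p,q)}(X)=\mathrm{E}[X\mid \mathrm{VaR}_{p}(X)\le X\le \mathrm{VaR}_{q}(X)]$ and the range variance is $\mathrm{RV}_{(p,q)}(X)=\mathrm{E}\left[(X-\mathrm{RVaR}_{(p,q)}(X))^{2}\mid \mathrm{VaR}_{p}(X)\le X\le \mathrm{VaR}_{q}(X)\right]$. For a density generator $h\ge0$ on $[0,\infty)$ with $\int_0^\infty s^{-1/2}h(s)\,ds<\infty$, $X\sim E_{1}(\mu,\sigma^{2},h)$ means that $X$ has density $\frac{c}{\sigma}h\left(\frac12\left(\frac{x-\mu}{\sigma}\right)^{2}\right)$, where $c=\frac{\Gamma(1/2)}{(2\pi)^{1/2}}\left[\int_{0}^{\infty}s^{-1/2}h(s)\,ds\right]^{-1}$. The constant $c$ is denoted $c_{1}$ when $h=g_{1}$ and $c_{1}^{*}$ when $h=\overline{G}_{1}$. The cumulative generators are $\overline{G}_{1}(u)=\int_{u}^{\infty}g_{1}(v)\,dv$ and $\overline{\mathcal{G}}_{1}(u)=\int_{u}^{\infty}\overline{G}_{1}(v)\,dv$. For a random variable $Z$ with density $f_Z$, $F_{Z}(a,b)=\int_{a}^{b}f_{Z}(z)\,dz$. *)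

theory Defs
  imports "HOL-Probability.Probability"
begin

section \<open>Risk measures\<close>

definition VaR :: "'a measure \<Rightarrow> ('a \<Rightarrow> real) \<Rightarrow> real \<Rightarrow> real" where
  "VaR M X p = Inf {x. \<P>(\<omega> in M. X \<omega> \<le> x) \<ge> p}"

text \<open>
  Elementary conditional expectation given an event \<open>A\<close> of positive probability:
  the expectation under the conditional probability measure, which is \<^const>\<open>uniform_measure\<close>.
\<close>

definition event_expectation :: "'a measure \<Rightarrow> ('a \<Rightarrow> real) \<Rightarrow> 'a set \<Rightarrow> real" where
  "event_expectation M X A = (\<integral>\<omega>. X \<omega> \<partial>uniform_measure M A)"

definition VaR_range :: "'a measure \<Rightarrow> ('a \<Rightarrow> real) \<Rightarrow> real \<Rightarrow> real \<Rightarrow> 'a set" where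
  "VaR_range M X p q = {\<omega> \<in> space M. VaR M X p \<le> X \<omega> \<and> X \<omega> \<le> VaR M X q}"

definition RVaR :: "'a measure \<Rightarrow> ('a \<Rightarrow> real) \<Rightarrow> real \<Rightarrow> real \<Rightarrow> real" where
  "RVaR M X p q = event_expectation M X (VaR_range M X p q)"

definition RV :: "'a measure \<Rightarrow> ('a \<Rightarrow> real) \<Rightarrow> real \<Rightarrow> real \<Rightarrow> real" where
  "RV M X p q = event_expectation M (\<lambda>\<omega>. (X \<omega> - RVaR M X p q)\<^sup>2) (VaR_range M X p q)"

section \<open>Univariate elliptical distributions\<close>

text \<open>
  Generators are \<^typ>\<open>ennreal\<close>-valued so that the (cumulative) integrals below have their
  extended meaning and \<open>< \<infinity>\<close> is a genuine condition; a Bochner integral would be \<open>0\<close> when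
  divergent. Only the values on \<open>[0, \<infinity>)\<close> matter.
\<close>

definition generator_integral :: "(real \<Rightarrow> ennreal) \<Rightarrow> ennreal" where
  "generator_integral h = (\<integral>\<^sup>+ s \<in> {0<..}. ennreal (s powr (-1/2)) * h s \<partial>lborel)"

definition density_generator :: "(real \<Rightarrow> ennreal) \<Rightarrow> bool" where
  "density_generator h \<longleftrightarrow>
     h \<in> borel_measurable (restrict_space borel {0..}) \<and>
     (\<forall>u\<ge>0. h u < \<infinity>) \<and> generator_integral h < \<infinity>"

definition normalizing_constant :: "(real \<Rightarrow> ennreal) \<Rightarrow> real" where
  "normalizing_constant h =
     Gamma (1/2) / (2 * pi) powr (1/2) * inverse (enn2real (generator_integral h))"

definition elliptical_density :: "real \<Rightarrow> real \<Rightarrow> (real \<Rightarrow> ennreal) \<Rightarrow> real \<Rightarrow> ennreal" where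
  "elliptical_density \<mu> \<sigma> h x =
     ennreal (normalizing_constant h / \<sigma>) * h (1/2 * ((x - \<mu>) / \<sigma>)\<^sup>2)"

text \<open>The distribution \<open>E\<^sub>1(\<mu>, \<sigma>\<^sup>2, h)\<close>; note that the scale parameter taken here is \<open>\<sigma>\<close>.\<close>

definition elliptical ::
    "'a measure \<Rightarrow> ('a \<Rightarrow> real) \<Rightarrow> real \<Rightarrow> real \<Rightarrow> (real \<Rightarrow> ennreal) \<Rightarrow> bool" where
  "elliptical M X \<mu> \<sigma> h \<longleftrightarrow>
     prob_space M \<and> 0 < \<sigma> \<and> density_generator h \<and>
     distributed M lborel X (elliptical_density \<mu> \<sigma> h)"

definition cumulative_generator :: "(real \<Rightarrow> ennreal) \<Rightarrow> real \<Rightarrow> ennreal" where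
  "cumulative_generator h u = (\<integral>\<^sup>+ v \<in> {u..}. h v \<partial>lborel)"

text \<open>
  \<open>F\<^sub>Z(a, b)\<close> is the integral of the density \<open>f\<^sub>Z\<close> of \<open>Z\<close> over \<open>[a, b]\<close>. The density is the
  Radon--Nikodym derivative of the law of \<open>Z\<close>; it agrees almost everywhere with every other
  density of \<open>Z\<close>, so the choice of version is immaterial.
\<close>

definition rv_density :: "'a measure \<Rightarrow> ('a \<Rightarrow> real) \<Rightarrow> real \<Rightarrow> real" where
  "rv_density M Z z = enn2real (RN_deriv lborel (distr M lborel Z) z)"

definition F_interval :: "'a measure \<Rightarrow> ('a \<Rightarrow> real) \<Rightarrow> real \<Rightarrow> real \<Rightarrow> real" where
  "F_interval M Z a b = (LBINT z=ereal a..ereal b. rv_density M Z z)"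

end

theory Submission imports Defs begin

text \<open>
  Standardize \<open>X = \<mu> + \<sigma> Z\<close>, so that \<open>Z\<close> has density \<open>f z = c g(z\<^sup>2/2)\<close>, and put
  \<open>a = (VaR p - \<mu>)/\<sigma>\<close>, \<open>b = (VaR q - \<mu>)/\<sigma>\<close>. The range variance is \<open>\<sigma>\<^sup>2\<close> times the variance of
  \<open>Z\<close> conditioned on \<open>a \<le> Z \<le> b\<close>, hence determined by the integrals of \<open>f\<close>, \<open>z f\<close> and
  \<open>z\<^sup>2 f\<close> over \<open>[a, b]\<close> (\<open>RV_eq_truncated_moments\<close>). The first of these is \<open>F_Y(a, b)\<close>. It is
  positive because \<open>X\<close> has no atoms, so that its distribution function takes the values \<open>p\<close> and \<open>q\<close> at
  the two quantiles (\<open>prob_le_VaR\<close>).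

  The remaining two are computed from one observation: if \<open>G\<close> is the cumulative generator, then
  \<open>z g(z\<^sup>2/2)\<close> is the derivative of \<open>-G(z\<^sup>2/2)\<close>. Integrating \<open>z f\<close> gives \<open>\<delta>\<close>
  (\<open>radial_first_moment\<close>). Integrating \<open>z\<^sup>2 f = c z \<cdot> z g(z\<^sup>2/2)\<close> by parts gives the boundary terms
  \<open>\<lambda>\<close> plus \<open>c\<close> times the integral of \<open>G(z\<^sup>2/2)\<close> (\<open>radial_second_moment\<close>), and
  \<open>c' G(z\<^sup>2/2)\<close> is the density of the variable with generator \<open>G\<close>, whence the term \<open>c/c'\<close> times
  its interval probability.

  A generator is only measurable, so the derivative above exists merely almost everywhere. The
  calculus is therefore replaced by the substitution \<open>v = z\<^sup>2/2\<close> for Lebesgue integrals in the first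
  moment and by Fubini on a triangle in the second (\<open>moment_about_left_endpoint\<close>).
\<close>

section \<open>Truncated moments of a function of \<open>z\<^sup>2/2\<close>\<close>

definition tail_integral :: "(real \<Rightarrow> real) \<Rightarrow> real \<Rightarrow> real" where
  "tail_integral \<gamma> u = (LBINT v:{u..}. \<gamma> v)"

lemma tail_integral_diff:
  assumes "set_integrable lborel {0..} \<gamma>" and "0 \<le> s" and "s \<le> t"
  shows "tail_integral \<gamma> s - tail_integral \<gamma> t = (LBINT v=s..t. \<gamma> v)"
proof -
  have "{s..} = {s..<t} \<union> {t..}" using assms by auto
  then have "tail_integral \<gamma> s = (LBINT v:{s..<t}. \<gamma> v) + tail_integral \<gamma> t"
    unfolding tail_integral_def using assms
    by (auto intro!: set_integral_Un set_integrable_subset[OF assms(1)])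
  then show ?thesis
    using assms by (simp add: interval_integral_Ico)
qed

text \<open>
  On the interval \<open>[0, x]\<close> the map \<open>z \<mapsto> z\<^sup>2/2\<close> is increasing with derivative \<open>z\<close>, so the
  substitution \<open>v = z\<^sup>2/2\<close> turns \<open>z \<gamma>(z\<^sup>2/2) dz\<close> into \<open>\<gamma>(v) dv\<close>. Since \<open>\<gamma>\<close> is
  merely integrable, this replaces differentiating the tail integral.
\<close>

lemma radial_first_moment_from_zero:
  assumes "set_integrable lborel {0..} \<gamma>" and "0 \<le> x"
  shows "set_integrable lborel {0..x} (\<lambda>z. z * \<gamma> (z\<^sup>2 / 2))"
    and "(LBINT z=0..x. z * \<gamma> (z\<^sup>2 / 2)) = tail_integral \<gamma> 0 - tail_integral \<gamma> (x\<^sup>2 / 2)"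
proof -
  have 1: "set_integrable lborel {0\<^sup>2/2 .. x\<^sup>2 / 2} \<gamma>"
    by (rule set_integrable_subset[OF assms(1)]) auto
  have 2: "((\<lambda>z. z\<^sup>2 / 2) has_real_derivative z) (at z)" for z :: real
    by (auto intro!: derivative_eq_intros)
  have 3: "continuous_on {0..x} (\<lambda>z. z)"
    by (intro continuous_intros)
  note subst = interval_integral_substitution[of "\<lambda>z. z\<^sup>2 / 2" 0 x \<gamma> "\<lambda>z. z", OF 1 2 3 _ assms(2)]
  show "set_integrable lborel {0..x} (\<lambda>z. z * \<gamma> (z\<^sup>2 / 2))"
    using subst(1) by (simp add: mult.commute)
  have "(LBINT z=ereal 0..x. \<gamma> (z\<^sup>2 / 2) * z) = (LBINT v=ereal 0..ereal (x\<^sup>2/2). \<gamma> v)"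
    using subst(2) by simp
  then show "(LBINT z=0..x. z * \<gamma> (z\<^sup>2 / 2)) = tail_integral \<gamma> 0 - tail_integral \<gamma> (x\<^sup>2 / 2)"
    using tail_integral_diff[OF assms(1), of 0 "x\<^sup>2/2"]
    by (simp add: mult.commute zero_ereal_def)
qed

lemma radial_first_moment_integrable:
  fixes a b :: real
  assumes "set_integrable lborel {0..} \<gamma>"
  shows "set_integrable lborel {a..b} (\<lambda>z. z * \<gamma> (z\<^sup>2 / 2))"
proof -
  define R where "R = max \<bar>a\<bar> \<bar>b\<bar>"
  let ?h = "\<lambda>z. indicator {0..R} z *\<^sub>R (z * \<gamma> (z\<^sup>2 / 2))"
  have h: "integrable lborel ?h"
    using radial_first_moment_from_zero(1)[OF assms, of R]
    unfolding set_integrable_def R_def by simp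
  \<comment> \<open>The integrand is odd, so its restriction to a symmetric interval is the antisymmetrization of \<open>?h\<close>.\<close>
  have "integrable lborel (\<lambda>z. ?h z - ?h (0 + (-1) * z))"
    by (intro Bochner_Integration.integrable_diff h lborel_integrable_real_affine[OF h, of "-1" 0]) simp
  also have "(\<lambda>z. ?h z - ?h (0 + (-1) * z)) = (\<lambda>z. indicator {-R..R} z *\<^sub>R (z * \<gamma> (z\<^sup>2 / 2)))"
    by (auto simp: indicator_def fun_eq_iff)
  finally have "set_integrable lborel {-R..R} (\<lambda>z. z * \<gamma> (z\<^sup>2 / 2))"
    unfolding set_integrable_def .
  then show ?thesis
    by (rule set_integrable_subset) (auto simp: R_def)
qed

text \<open>
  The integrand is odd, so its integral from \<open>0\<close> to \<open>x\<close> is even in \<open>x\<close>, as is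
  \<open>tail_integral \<gamma> (x\<^sup>2/2)\<close>. The formula on \<open>[0, x]\<close> therefore extends to \<open>x < 0\<close>, and additivity
  of the oriented integral handles intervals on either side of, or across, the origin.
\<close>

lemma radial_first_moment:
  assumes "set_integrable lborel {0..} \<gamma>" and "a \<le> b"
  shows "(LBINT z:{a..b::real}. z * \<gamma> (z\<^sup>2 / 2)) = tail_integral \<gamma> (a\<^sup>2 / 2) - tail_integral \<gamma> (b\<^sup>2 / 2)"
proof -
  let ?k = "\<lambda>z. z * \<gamma> (z\<^sup>2 / 2)"
  have from_zero: "(LBINT z=0..ereal x. ?k z) = tail_integral \<gamma> 0 - tail_integral \<gamma> (x\<^sup>2 / 2)" for x
  proof (cases "0 \<le> x")
    case True
    then show ?thesis using radial_first_moment_from_zero(2)[OF assms(1)] by simp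
  next
    case False
    have "(LBINT z=0..ereal x. ?k z) = (LBINT z=-ereal x..-0. ?k (-z))"
      using interval_integral_reflect[of 0 "ereal x" ?k] by simp
    also have "\<dots> = (LBINT z=0..ereal (-x). ?k z)"
      by (subst interval_integral_endpoints_reverse)
        (simp flip: interval_lebesgue_integral_uminus)
    finally show ?thesis
      using False radial_first_moment_from_zero(2)[OF assms(1), of "-x"] by simp
  qed
  have "interval_lebesgue_integrable lborel (min 0 (min (ereal a) b)) (max 0 (max (ereal a) b)) ?k"
  proof -
    define l r where "l = min 0 (min a b)" and "r = max 0 (max a b)"
    have eq: "min 0 (min (ereal a) b) = ereal l" "max 0 (max (ereal a) b) = ereal r" and "l \<le> r"
      by (auto simp: l_def r_def min_def max_def zero_ereal_def)
    have "set_integrable lborel {l<..<r} ?k"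
      by (rule set_integrable_subset[OF radial_first_moment_integrable[OF assms(1), of l r]]) auto
    then show ?thesis
      unfolding eq using \<open>l \<le> r\<close> by (simp add: interval_lebesgue_integrable_def)
  qed
  then have "(LBINT z=0..ereal a. ?k z) + (LBINT z=ereal a..ereal b. ?k z) = (LBINT z=0..ereal b. ?k z)"
    by (rule interval_integral_sum)
  then show ?thesis
    using assms(2) by (simp add: from_zero interval_integral_Icc)
qed

text \<open>
  Integration by parts for \<open>k\<close> against the affine function \<open>z - a\<close>, in the form given by Fubini:
  write \<open>z - a\<close> as the length of \<open>[a, z]\<close> and exchange the order of integration over the triangle
  \<open>a \<le> w \<le> z \<le> b\<close>. Classical integration by parts would ask that \<open>k\<close> be a derivative at
  every point. The integrability of the inner integral makes the outer one split over sums.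
\<close>

lemma moment_about_left_endpoint:
  fixes k :: "real \<Rightarrow> real"
  assumes k: "set_integrable lborel {a..b} k"
  shows "set_integrable lborel {a..b} (\<lambda>w. LBINT z:{w..b}. k z)"
    and "(LBINT z:{a..b}. (z - a) * k z) = (LBINT w:{a..b}. LBINT z:{w..b}. k z)"
proof -
  define I where "I = (\<lambda>z. indicator {a..b} z *\<^sub>R k z)"
  let ?F = "\<lambda>z w. indicator {a..z} w * I z :: real"
  have I: "integrable lborel I" using k unfolding set_integrable_def I_def .
  have [measurable]: "I \<in> borel_measurable borel" using I by auto
  have "(\<lambda>p. if a \<le> snd p \<and> snd p \<le> fst p then I (fst p) else 0)
      \<in> borel_measurable (lborel \<Otimes>\<^sub>M lborel)"
    by measurable
  also have "(\<lambda>p. if a \<le> snd p \<and> snd p \<le> fst p then I (fst p) else 0) = case_prod ?F"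
    by (auto simp: fun_eq_iff indicator_def)
  finally have meas: "case_prod ?F \<in> borel_measurable (lborel \<Otimes>\<^sub>M lborel)" .
  have row: "integrable lborel (\<lambda>w. ?F z w)" for z
    by (intro integrable_mult_left) (simp add: integrable_indicator_iff emeasure_lborel_Icc_eq)
  have row_int: "(\<integral>w. ?F z w \<partial>lborel) = indicator {a..b} z *\<^sub>R ((z - a) * k z)" for z
    by (cases "z \<in> {a..b}") (simp_all add: I_def)
  have row_norm: "(\<integral>w. norm (?F z w) \<partial>lborel) = (z - a) * norm (I z)" for z
  proof -
    have "(\<integral>w. norm (?F z w) \<partial>lborel) = (\<integral>w. indicator {a..z} w * norm (I z) \<partial>lborel)"
      by (intro Bochner_Integration.integral_cong) (auto simp: abs_mult)
    also have "\<dots> = (z - a) * norm (I z)"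
      by (cases "z \<in> {a..b}") (simp_all add: I_def)
    finally show ?thesis .
  qed
  have "integrable lborel (\<lambda>z. (z - a) * norm (I z))"
  proof (rule Bochner_Integration.integrable_bound)
    show "integrable lborel (\<lambda>z. (b - a) * norm (I z))"
      using I by auto
    show "AE z in lborel. norm ((z - a) * norm (I z)) \<le> norm ((b - a) * norm (I z))"
      by (auto simp: I_def indicator_def abs_mult intro!: mult_right_mono)
  qed measurable
  then have F: "integrable (lborel \<Otimes>\<^sub>M lborel) (case_prod ?F)"
    using row by (intro lborel_pair.Fubini_integrable[OF meas]) (simp_all only: row_norm prod.case AE_I2)
  have column: "(\<integral>z. ?F z w \<partial>lborel) = indicator {a..b} w *\<^sub>R (LBINT z:{w..b}. k z)" for w
  proof -
    have "?F z w = indicator {a..b} w * (indicator {w..b} z *\<^sub>R k z)" for z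
      by (auto simp: I_def indicator_def)
    then show ?thesis unfolding set_lebesgue_integral_def by simp
  qed
  show "set_integrable lborel {a..b} (\<lambda>w. LBINT z:{w..b}. k z)"
    using lborel_pair.integrable_snd[OF F] unfolding column set_integrable_def .
  show "(LBINT z:{a..b}. (z - a) * k z) = (LBINT w:{a..b}. LBINT z:{w..b}. k z)"
    using lborel_pair.Fubini_integral[OF F]
    unfolding row_int column set_lebesgue_integral_def[of _ "{a..b}"] by simp
qed

lemma set_integrable_id_mult:
  fixes a b :: real and k :: "real \<Rightarrow> real"
  assumes k: "set_integrable lborel {a..b} k"
  shows "set_integrable lborel {a..b} (\<lambda>z. z * k z)"
  unfolding set_integrable_def
proof (rule Bochner_Integration.integrable_bound)
  define I where "I = (\<lambda>z. indicator {a..b} z *\<^sub>R k z)"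
  have I: "integrable lborel I" using k unfolding set_integrable_def I_def .
  then show "integrable lborel (\<lambda>z. max \<bar>a\<bar> \<bar>b\<bar> * I z)"
    by simp
  have [measurable]: "I \<in> borel_measurable borel" using I by auto
  have eq: "(\<lambda>z. indicator {a..b} z *\<^sub>R (z * k z)) = (\<lambda>z. z * I z)"
    by (simp add: I_def mult_ac)
  show "(\<lambda>z. indicator {a..b} z *\<^sub>R (z * k z)) \<in> borel_measurable lborel"
    unfolding eq by measurable
  \<comment> \<open>On \<open>[a, b]\<close> the factor \<open>z\<close> is bounded by \<open>max \<bar>a\<bar> \<bar>b\<bar>\<close>, off it both sides vanish.\<close>
  show "AE z in lborel. norm (indicator {a..b} z *\<^sub>R (z * k z)) \<le> norm (max \<bar>a\<bar> \<bar>b\<bar> * I z)"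
    by (auto simp: I_def indicator_def abs_mult intro!: mult_right_mono)
qed

lemma radial_second_moment_integrable:
  fixes a b :: real
  assumes "set_integrable lborel {0..} \<gamma>"
  shows "set_integrable lborel {a..b} (\<lambda>z. z\<^sup>2 * \<gamma> (z\<^sup>2 / 2))"
  using set_integrable_id_mult[OF radial_first_moment_integrable[OF assms]]
  by (simp add: power2_eq_square mult.assoc)

text \<open>
  Formally this is \<open>\<integral> z \<cdot> z \<gamma>(z\<^sup>2/2) dz\<close> integrated by parts, where \<open>z \<gamma>(z\<^sup>2/2)\<close> is the derivative of
  \<open>-H\<close> with \<open>H z = tail_integral \<gamma> (z\<^sup>2/2)\<close>. The factor \<open>z\<close> is split as \<open>(z - a) + a\<close>: the
  first summand is covered by \<open>moment_about_left_endpoint\<close>, whose inner integrals are the differences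
  \<open>H w - H b\<close> of \<open>radial_first_moment\<close>, and the second by \<open>radial_first_moment\<close> itself.
\<close>

lemma radial_second_moment:
  assumes \<gamma>: "set_integrable lborel {0..} \<gamma>"
    and "a \<le> b"
  shows "(LBINT z:{a..b}. z\<^sup>2 * \<gamma> (z\<^sup>2 / 2)) =
    a * tail_integral \<gamma> (a\<^sup>2 / 2) - b * tail_integral \<gamma> (b\<^sup>2 / 2)
      + (LBINT z:{a..b}. tail_integral \<gamma> (z\<^sup>2 / 2))"
proof -
  let ?k = "\<lambda>z. z * \<gamma> (z\<^sup>2 / 2)"
  let ?H = "\<lambda>z. tail_integral \<gamma> (z\<^sup>2 / 2)"
  have k: "set_integrable lborel {a..b} ?k"
    by (rule radial_first_moment_integrable[OF \<gamma>])
  have tail: "set_integrable lborel {a..b} (\<lambda>w. ?H w - ?H b)"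
    by (rule set_integrable_cong[THEN iffD1, OF refl refl _ moment_about_left_endpoint(1)[OF k]])
      (simp add: radial_first_moment[OF \<gamma>])
  have const: "set_integrable lborel {a..b} (\<lambda>_. ?H b)"
    by (rule borel_integrable_atLeastAtMost') (rule continuous_on_const)
  have tail: "set_integrable lborel {a..b} ?H"
    using set_integral_add(1)[OF tail const] by simp
  have zk: "set_integrable lborel {a..b} (\<lambda>z. (z - a) * ?k z)"
    using set_integral_diff(1)[OF set_integrable_id_mult[OF k] set_integrable_mult_right[OF k, of a]]
    by (simp add: left_diff_distrib)
  have "(LBINT z:{a..b}. z\<^sup>2 * \<gamma> (z\<^sup>2 / 2)) = (LBINT z:{a..b}. (z - a) * ?k z + a * ?k z)"
    by (intro set_lebesgue_integral_cong) (auto simp: algebra_simps power2_eq_square)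
  also have "\<dots> = (LBINT z:{a..b}. (z - a) * ?k z) + a * (LBINT z:{a..b}. ?k z)"
    using zk k by (subst set_integral_add) auto
  also have "(LBINT z:{a..b}. (z - a) * ?k z) = (LBINT w:{a..b}. LBINT z:{w..b}. ?k z)"
    by (rule moment_about_left_endpoint(2)[OF k])
  also have "\<dots> = (LBINT w:{a..b}. ?H w - ?H b)"
    by (intro set_lebesgue_integral_cong) (auto simp: radial_first_moment[OF \<gamma>])
  also have "\<dots> = (LBINT w:{a..b}. ?H w) - (b - a) * ?H b"
    using \<open>a \<le> b\<close> by (subst set_integral_diff(2)[OF tail const]) (simp add: set_lebesgue_integral_def)
  also have "(LBINT z:{a..b}. ?k z) = ?H a - ?H b"
    by (rule radial_first_moment[OF \<gamma> \<open>a \<le> b\<close>])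
  finally show ?thesis by (simp add: algebra_simps)
qed

section \<open>Value at risk of a distribution without atoms\<close>

text \<open>
  Without atoms the distribution function \<open>F\<close> is continuous. Then \<open>{x. p \<le> F x}\<close> is closed, so it
  contains its infimum, which gives \<open>p \<le> F (VaR p)\<close>; to the left of the infimum \<open>F\<close> is below
  \<open>p\<close>, and left continuity gives the other inequality. The bounds on \<open>p\<close> make the set nonempty and
  bounded below, without which the infimum would have no meaning.
\<close>

lemma (in prob_space) prob_le_VaR:
  assumes X: "random_variable borel X" and no_atoms: "\<And>x. \<P>(\<omega> in M. X \<omega> = x) = 0"
    and "0 < p" and "p < 1"
  shows "\<P>(\<omega> in M. X \<omega> \<le> VaR M X p) = p"
proof -
  note [measurable] = X
  interpret D: real_distribution "distr M borel X"
    by (rule real_distribution_distr) (rule X)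
  let ?F = "\<lambda>x. \<P>(\<omega> in M. X \<omega> \<le> x)"
  have F_cdf: "?F x = cdf (distr M borel X) x" for x
    by (auto simp: cdf_def measure_distr intro!: arg_cong[where f="measure M"])
  have mono: "x \<le> y \<Longrightarrow> ?F x \<le> ?F y" for x y
    unfolding F_cdf by (rule D.cdf_nondecreasing)
  have isCont: "isCont ?F x" for x
    unfolding F_cdf D.isCont_cdf using no_atoms[of x]
    by (simp add: measure_distr vimage_def Int_def conj_commute)
  let ?S = "{x. p \<le> ?F x}"
  have "closed ?S"
    by (intro closed_Collect_le continuous_on_const continuous_at_imp_continuous_on ballI isCont)
  moreover have "eventually (\<lambda>x. p < ?F x) at_top"
    using D.cdf_lim_at_top_prob \<open>p < 1\<close> unfolding F_cdf by (rule order_tendstoD(1))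
  then have "?S \<noteq> {}"
    by (auto simp: eventually_at_top_linorder intro: less_imp_le)
  moreover have "eventually (\<lambda>x. ?F x < p) at_bot"
    using D.cdf_lim_at_bot \<open>0 < p\<close> unfolding F_cdf by (rule order_tendstoD(2))
  then obtain l where "?F l < p"
    by (auto simp: eventually_at_bot_linorder)
  then have "l \<le> x" if "x \<in> ?S" for x
    using that mono[of x l] by (cases "l \<le> x") auto
  then have bdd: "bdd_below ?S"
    by (rule bdd_belowI)
  ultimately have "VaR M X p \<in> ?S"
    unfolding VaR_def by (intro closed_contains_Inf)
  then have "p \<le> ?F (VaR M X p)"
    by simp
  moreover have "?F x \<le> p" if "x < VaR M X p" for x
    using that cInf_lower[OF _ bdd, of x] unfolding VaR_def by (cases "p \<le> ?F x") auto
  then have "eventually (\<lambda>x. ?F x \<le> p) (at_left (VaR M X p))"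
    by (simp add: eventually_at_left_field) (meson lt_ex)
  then have "?F (VaR M X p) \<le> p"
    using isCont[of "VaR M X p"]
    by (intro tendsto_upperbound[of ?F _ "at_left (VaR M X p)"])
      (auto simp: isCont_def intro: tendsto_within_subset)
  ultimately show ?thesis
    by simp
qed


section \<open>Expectations of elliptical variables\<close>

text \<open>
  The density of \<open>E\<^sub>1(0, 1, h)\<close> as a real function, so that Bochner integrals and signed
  integrands can be used; \<open>elliptical_density_eq\<close> recovers every \<open>E\<^sub>1(\<mu>, \<sigma>\<^sup>2, h)\<close> from it.
\<close>

definition standard_density :: "(real \<Rightarrow> ennreal) \<Rightarrow> real \<Rightarrow> real" where
  "standard_density h z = normalizing_constant h * enn2real (h (z\<^sup>2 / 2))"

lemma normalizing_constant_nonneg: "0 \<le> normalizing_constant h"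
  unfolding normalizing_constant_def
  by (intro mult_nonneg_nonneg divide_nonneg_nonneg) (auto simp: Gamma_one_half_real)

lemma standard_density_nonneg: "0 \<le> standard_density h z"
  by (simp add: standard_density_def normalizing_constant_nonneg)

lemma elliptical_density_eq:
  assumes "density_generator h" and "0 < \<sigma>"
  shows "elliptical_density \<mu> \<sigma> h x = ennreal (standard_density h ((x - \<mu>) / \<sigma>) / \<sigma>)"
proof -
  have "h (((x - \<mu>) / \<sigma>)\<^sup>2 / 2) < \<infinity>"
    using assms(1) by (simp add: density_generator_def)
  then have "h (((x - \<mu>) / \<sigma>)\<^sup>2 / 2) = ennreal (enn2real (h (((x - \<mu>) / \<sigma>)\<^sup>2 / 2)))"
    by (simp add: top.not_eq_extremum)
  then have "elliptical_density \<mu> \<sigma> h x =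
      ennreal (normalizing_constant h / \<sigma>) * ennreal (enn2real (h (((x - \<mu>) / \<sigma>)\<^sup>2 / 2)))"
    by (simp add: elliptical_density_def)
  then show ?thesis
    using \<open>0 < \<sigma>\<close>
    by (simp add: standard_density_def normalizing_constant_nonneg flip: ennreal_mult)
qed

context
  fixes M :: "'a measure" and X :: "'a \<Rightarrow> real" and \<mu> \<sigma> :: real and h :: "real \<Rightarrow> ennreal"
  assumes X: "elliptical M X \<mu> \<sigma> h"
begin

interpretation prob_space M
  using X by (simp add: elliptical_def)

lemma elliptical_scale_pos: "0 < \<sigma>"
  using X by (simp add: elliptical_def)

lemma elliptical_distributed:
  "distributed M lborel X (\<lambda>x. ennreal (standard_density h ((x - \<mu>) / \<sigma>) / \<sigma>))"
proof -
  have "elliptical_density \<mu> \<sigma> h = (\<lambda>x. ennreal (standard_density h ((x - \<mu>) / \<sigma>) / \<sigma>))"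
    using X by (auto simp: elliptical_def elliptical_density_eq)
  then show ?thesis
    using X by (simp add: elliptical_def)
qed

lemma elliptical_random_variable: "X \<in> borel_measurable M"
  using distributed_measurable[OF elliptical_distributed] by simp

lemma standard_density_measurable: "standard_density h \<in> borel_measurable borel"
proof -
  have "(\<lambda>x. standard_density h ((x - \<mu>) / \<sigma>) / \<sigma>) \<in> borel_measurable borel"
    using distributed_real_measurable[OF _ elliptical_distributed] elliptical_scale_pos
    by (simp add: standard_density_nonneg)
  then have "(\<lambda>z. \<sigma> * (standard_density h ((\<mu> + \<sigma> * z - \<mu>) / \<sigma>) / \<sigma>)) \<in> borel_measurable borel"
    by measurable
  then show ?thesis
    using elliptical_scale_pos by simp
qed

text \<open>
  The change of variable \<open>x = \<mu> + \<sigma> z\<close> that reduces every expectation to the standard density.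
\<close>

lemma elliptical_expectation:
  assumes \<phi>: "\<phi> \<in> borel_measurable borel"
  shows "expectation (\<lambda>\<omega>. \<phi> (X \<omega>)) = (\<integral>z. \<phi> (\<mu> + \<sigma> * z) * standard_density h z \<partial>lborel)"
proof -
  have "expectation (\<lambda>\<omega>. \<phi> (X \<omega>)) =
      (\<integral>x. standard_density h ((x - \<mu>) / \<sigma>) / \<sigma> * \<phi> x \<partial>lborel)"
    using elliptical_scale_pos \<phi>
    by (intro distributed_integral[OF elliptical_distributed, symmetric])
      (simp_all add: standard_density_nonneg)
  also have "\<dots> = (\<integral>z. \<phi> (\<mu> + \<sigma> * z) * standard_density h z \<partial>lborel)"
    using elliptical_scale_pos by (subst lborel_integral_real_affine[of \<sigma> _ \<mu>]) (simp_all add: mult.commute)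
  finally show ?thesis .
qed

text \<open>
  Total mass one yields two facts at once: a Bochner integral different from \<open>0\<close> forces
  integrability, and the normalizing constant cannot vanish.
\<close>

lemma integral_standard_density: "(\<integral>z. standard_density h z \<partial>lborel) = 1"
  using elliptical_expectation[of "\<lambda>_. 1"] prob_space by simp

lemma integrable_standard_density: "integrable lborel (standard_density h)"
  using integral_standard_density not_integrable_integral_eq by force

lemma normalizing_constant_nonzero: "normalizing_constant h \<noteq> 0"
  using integral_standard_density by (auto simp: standard_density_def)

lemma elliptical_no_atoms: "\<P>(\<omega> in M. X \<omega> = x) = 0"
proof -
  have "emeasure M (X -` {x} \<inter> space M) = 0"
    using distributed_emeasure[OF elliptical_distributed, of "{x}"] by simp
  then show ?thesis
    by (simp add: measure_def vimage_def Int_def conj_commute)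
qed

lemma elliptical_expectation_on_interval:
  assumes [measurable]: "\<phi> \<in> borel_measurable borel"
  shows "expectation (\<lambda>\<omega>. indicator {\<omega> \<in> space M. a \<le> X \<omega> \<and> X \<omega> \<le> b} \<omega> * \<phi> (X \<omega>)) =
    (LBINT z:{(a - \<mu>) / \<sigma>..(b - \<mu>) / \<sigma>}. \<phi> (\<mu> + \<sigma> * z) * standard_density h z)"
proof -
  have preimage: "indicator {a..b} (\<mu> + \<sigma> * z) = indicat_real {(a - \<mu>) / \<sigma>..(b - \<mu>) / \<sigma>} z" for z
    using elliptical_scale_pos by (auto simp: indicator_def field_simps)
  have "expectation (\<lambda>\<omega>. indicator {\<omega> \<in> space M. a \<le> X \<omega> \<and> X \<omega> \<le> b} \<omega> * \<phi> (X \<omega>)) =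
      expectation (\<lambda>\<omega>. indicator {a..b} (X \<omega>) * \<phi> (X \<omega>))"
    by (intro Bochner_Integration.integral_cong) (auto simp: indicator_def)
  also have "\<dots> = (\<integral>z. indicator {a..b} (\<mu> + \<sigma> * z) * \<phi> (\<mu> + \<sigma> * z) * standard_density h z \<partial>lborel)"
    by (rule elliptical_expectation) measurable
  finally show ?thesis
    by (simp add: preimage set_lebesgue_integral_def mult.assoc)
qed

end

lemma (in prob_space) event_expectation_eq:
  assumes [measurable]: "Z \<in> borel_measurable M" "A \<in> sets M" and "prob A > 0"
  shows "event_expectation M Z A = expectation (\<lambda>\<omega>. indicator A \<omega> * Z \<omega>) / prob A"
proof -
  have "uniform_measure M A = density M (\<lambda>\<omega>. ennreal (indicator A \<omega> / prob A))"
    unfolding uniform_measure_def using \<open>prob A > 0\<close>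
    by (intro density_cong) (auto simp: emeasure_eq_measure ennreal_indicator divide_ennreal[symmetric])
  then have "event_expectation M Z A = expectation (\<lambda>\<omega>. indicator A \<omega> / prob A * Z \<omega>)"
    unfolding event_expectation_def by (simp add: integral_real_density)
  then show ?thesis by simp
qed

text \<open>
  The Radon--Nikodym derivative agrees with the explicit density only almost everywhere, which is
  enough under the integral.
\<close>

lemma F_interval_elliptical:
  assumes Y: "elliptical N Y 0 1 h" and "a \<le> b"
  shows "F_interval N Y a b = (LBINT z:{a..b}. standard_density h z)"
proof -
  have "AE z in lborel. ennreal (standard_density h z) = RN_deriv lborel (distr N lborel Y) z"
    using elliptical_distributed[OF Y]
    by (intro sigma_finite_measure.RN_deriv_unique[OF sigma_finite_lborel]) (simp_all add: distributed_def)
  then have ae: "AE z in lborel. rv_density N Y z = standard_density h z"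
    by eventually_elim (metis rv_density_def enn2real_ennreal standard_density_nonneg)
  have "F_interval N Y a b = (LBINT z:{a..b}. rv_density N Y z)"
    unfolding F_interval_def using \<open>a \<le> b\<close> by (rule interval_integral_Icc)
  also have "\<dots> = (LBINT z:{a..b}. standard_density h z)"
    unfolding set_lebesgue_integral_def
  proof (intro Bochner_Integration.integral_cong_AE)
    show "(\<lambda>z. indicator {a..b} z *\<^sub>R rv_density N Y z) \<in> borel_measurable lborel"
      unfolding rv_density_def by measurable
    show "(\<lambda>z. indicator {a..b} z *\<^sub>R standard_density h z) \<in> borel_measurable lborel"
      using standard_density_measurable[OF Y] by measurable
  qed (use ae in auto)
  finally show ?thesis .
qed

section \<open>Cumulative generators\<close>

text \<open>
  The bridge between the extended nonnegative integral that defines a cumulative generator and the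
  Bochner tail integral used for the truncated moments: the two agree once the former is finite at
  \<open>0\<close>.
\<close>

lemma generator_integrable:
  assumes h: "density_generator h" and fin: "cumulative_generator h 0 < \<infinity>"
  shows "set_integrable lborel {0..} (\<lambda>v. enn2real (h v))"
    and "0 \<le> u \<Longrightarrow> tail_integral (\<lambda>v. enn2real (h v)) u = enn2real (cumulative_generator h u)"
proof -
  have "(\<lambda>v. h v * indicator {0..} v) \<in> borel_measurable borel"
    using h by (simp add: density_generator_def borel_measurable_restrict_space_iff_ennreal)
  then have meas: "(\<lambda>v. enn2real (h v * indicator {0..} v)) \<in> borel_measurable borel"
    by measurable
  have restr: "enn2real (h v * indicator A v) = indicator A v *\<^sub>R enn2real (h v)" for v and A :: "real set"
    by (simp add: indicator_def)
  have fin_h: "0 \<le> v \<Longrightarrow> ennreal (enn2real (h v)) = h v" for v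
    using h by (simp add: density_generator_def top.not_eq_extremum)
  show int: "set_integrable lborel {0..} (\<lambda>v. enn2real (h v))"
    unfolding set_integrable_def
  proof (rule integrableI_nonneg)
    have "(\<integral>\<^sup>+v. ennreal (indicator {0..} v *\<^sub>R enn2real (h v)) \<partial>lborel) = cumulative_generator h 0"
      unfolding cumulative_generator_def
      by (intro nn_integral_cong) (auto simp: fin_h indicator_def)
    then show "(\<integral>\<^sup>+v. ennreal (indicator {0..} v *\<^sub>R enn2real (h v)) \<partial>lborel) < \<infinity>"
      using fin by simp
  qed (use meas in \<open>auto simp: restr\<close>)
  assume "0 \<le> u"
  then have "set_integrable lborel {u..} (\<lambda>v. enn2real (h v))"
    by (intro set_integrable_subset[OF int]) auto
  then have "tail_integral (\<lambda>v. enn2real (h v)) u =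
      enn2real (\<integral>\<^sup>+v. ennreal (indicator {u..} v *\<^sub>R enn2real (h v)) \<partial>lborel)"
    unfolding tail_integral_def set_lebesgue_integral_def set_integrable_def
    by (intro integral_eq_nn_integral) auto
  also have "(\<integral>\<^sup>+v. ennreal (indicator {u..} v *\<^sub>R enn2real (h v)) \<partial>lborel) = cumulative_generator h u"
    unfolding cumulative_generator_def using \<open>0 \<le> u\<close>
    by (intro nn_integral_cong) (auto simp: fin_h indicator_def)
  finally show "tail_integral (\<lambda>v. enn2real (h v)) u = enn2real (cumulative_generator h u)" .
qed

section \<open>Conditioning on the range between two quantiles\<close>

context
  fixes M :: "'a measure" and X :: "'a \<Rightarrow> real" and \<mu> \<sigma> :: real and h :: "real \<Rightarrow> ennreal" and p q :: real
  assumes X: "elliptical M X \<mu> \<sigma> h" and p: "0 < p" and pq: "p < q" and q: "q < 1"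
begin

interpretation prob_space M
  using X by (simp add: elliptical_def)

lemma VaR_strict_mono: "VaR M X p < VaR M X q"
proof (rule ccontr)
  note [measurable] = elliptical_random_variable[OF X]
  assume "\<not> VaR M X p < VaR M X q"
  then have "\<P>(\<omega> in M. X \<omega> \<le> VaR M X q) \<le> \<P>(\<omega> in M. X \<omega> \<le> VaR M X p)"
    by (intro finite_measure_mono) auto
  then show False
    using p pq q prob_le_VaR[OF elliptical_random_variable[OF X] elliptical_no_atoms[OF X]] by simp
qed

lemma VaR_range_sets: "VaR_range M X p q \<in> sets M"
  using elliptical_random_variable[OF X] unfolding VaR_range_def by measurable

text \<open>
  The event between the quantiles has positive probability, so that conditioning on it is genuine:
  \<open>{X \<le> VaR q}\<close> has probability \<open>q\<close> and is covered by the event and \<open>{X \<le> VaR p}\<close>, which has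
  probability \<open>p\<close>.
\<close>

lemma prob_VaR_range_pos: "0 < prob (VaR_range M X p q)"
proof -
  note [measurable] = elliptical_random_variable[OF X] and [simp] = VaR_range_sets
  have "q = \<P>(\<omega> in M. X \<omega> \<le> VaR M X q)"
    using p pq q prob_le_VaR[OF elliptical_random_variable[OF X] elliptical_no_atoms[OF X]] by simp
  also have "\<dots> \<le> prob ({\<omega> \<in> space M. X \<omega> \<le> VaR M X p} \<union> VaR_range M X p q)"
    by (intro finite_measure_mono) (auto simp: VaR_range_def)
  also have "\<dots> \<le> \<P>(\<omega> in M. X \<omega> \<le> VaR M X p) + prob (VaR_range M X p q)"
    by (intro measure_Un_le) auto
  also have "\<P>(\<omega> in M. X \<omega> \<le> VaR M X p) = p"
    using p pq q prob_le_VaR[OF elliptical_random_variable[OF X] elliptical_no_atoms[OF X]] by simp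
  finally show ?thesis
    using pq by simp
qed

lemma prob_VaR_range:
  "prob (VaR_range M X p q) =
    (LBINT z:{(VaR M X p - \<mu>) / \<sigma>..(VaR M X q - \<mu>) / \<sigma>}. standard_density h z)"
  using elliptical_expectation_on_interval[OF X, of "\<lambda>_. 1" "VaR M X p" "VaR M X q"] VaR_range_sets
  by (simp flip: VaR_range_def)

lemma event_expectation_VaR_range:
  assumes [measurable]: "\<phi> \<in> borel_measurable borel"
  shows "event_expectation M (\<lambda>\<omega>. \<phi> (X \<omega>)) (VaR_range M X p q) =
    (LBINT z:{(VaR M X p - \<mu>) / \<sigma>..(VaR M X q - \<mu>) / \<sigma>}. \<phi> (\<mu> + \<sigma> * z) * standard_density h z)
      / (LBINT z:{(VaR M X p - \<mu>) / \<sigma>..(VaR M X q - \<mu>) / \<sigma>}. standard_density h z)"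
proof -
  note [measurable] = elliptical_random_variable[OF X]
  have "event_expectation M (\<lambda>\<omega>. \<phi> (X \<omega>)) (VaR_range M X p q) =
      expectation (\<lambda>\<omega>. indicator (VaR_range M X p q) \<omega> * \<phi> (X \<omega>)) / prob (VaR_range M X p q)"
    by (intro event_expectation_eq VaR_range_sets prob_VaR_range_pos) measurable
  then show ?thesis
    unfolding prob_VaR_range
    using elliptical_expectation_on_interval[OF X assms] by (simp add: VaR_range_def)
qed

text \<open>
  The conditional variance of \<open>X = \<mu> + \<sigma> Z\<close> is \<open>\<sigma>\<^sup>2\<close> times that of \<open>Z\<close>, and the conditional moments
  of \<open>Z\<close> are the truncated moments \<open>m1\<close> and \<open>m2\<close> divided by the mass \<open>m0\<close>; this is
  \<open>E Z\<^sup>2 - (E Z)\<^sup>2\<close> in those terms.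
\<close>

lemma RV_eq_truncated_moments:
  fixes a b :: real
  defines "a \<equiv> (VaR M X p - \<mu>) / \<sigma>" and "b \<equiv> (VaR M X q - \<mu>) / \<sigma>"
  assumes int1: "set_integrable lborel {a..b} (\<lambda>z. z * standard_density h z)"
    and int2: "set_integrable lborel {a..b} (\<lambda>z. z\<^sup>2 * standard_density h z)"
  defines "m0 \<equiv> LBINT z:{a..b}. standard_density h z"
    and "m1 \<equiv> LBINT z:{a..b}. z * standard_density h z"
    and "m2 \<equiv> LBINT z:{a..b}. z\<^sup>2 * standard_density h z"
  shows "RV M X p q = \<sigma>\<^sup>2 / m0 * (m2 - m1\<^sup>2 / m0)"
proof -
  let ?f = "standard_density h"
  have pos: "0 < m0"
    using prob_VaR_range_pos prob_VaR_range by (simp add: m0_def a_def b_def)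
  have int0: "set_integrable lborel {a..b} ?f"
    by (rule set_integrable_subset[where A=UNIV])
      (auto simp: set_integrable_def integrable_standard_density[OF X])
  have "RVaR M X p q = (LBINT z:{a..b}. (\<mu> + \<sigma> * z) * ?f z) / m0"
    unfolding RVaR_def using event_expectation_VaR_range[of "\<lambda>x. x"]
    by (simp add: m0_def a_def b_def)
  also have "(LBINT z:{a..b}. (\<mu> + \<sigma> * z) * ?f z) = (LBINT z:{a..b}. \<mu> * ?f z + \<sigma> * (z * ?f z))"
    by (simp add: algebra_simps)
  also have "\<dots> = \<mu> * m0 + \<sigma> * m1"
    using int0 int1 by (subst set_integral_add(2)) (auto simp: m0_def m1_def)
  finally have RVaR: "RVaR M X p q = \<mu> + \<sigma> * (m1 / m0)"
    using pos by (simp add: field_simps)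
  have "RV M X p q = (LBINT z:{a..b}. (\<mu> + \<sigma> * z - RVaR M X p q)\<^sup>2 * ?f z) / m0"
    unfolding RV_def using event_expectation_VaR_range[of "\<lambda>x. (x - RVaR M X p q)\<^sup>2"]
    by (simp add: m0_def a_def b_def)
  also have "(LBINT z:{a..b}. (\<mu> + \<sigma> * z - RVaR M X p q)\<^sup>2 * ?f z) =
      (LBINT z:{a..b}. \<sigma>\<^sup>2 * (z\<^sup>2 * ?f z) + (\<sigma>\<^sup>2 * (m1 / m0)\<^sup>2 * ?f z - 2 * \<sigma>\<^sup>2 * (m1 / m0) * (z * ?f z)))"
    unfolding RVaR by (simp add: algebra_simps power2_eq_square)
  also have "\<dots> = \<sigma>\<^sup>2 * m2 + (\<sigma>\<^sup>2 * (m1 / m0)\<^sup>2 * m0 - 2 * \<sigma>\<^sup>2 * (m1 / m0) * m1)"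
    using int0 int1 int2
    by (simp only: set_integral_add(2) set_integral_diff set_integrable_mult_right_iff
        set_integral_mult_right m0_def m1_def m2_def set_integrable_mult_right)
  also have "\<dots> / m0 = \<sigma>\<^sup>2 / m0 * (m2 - m1\<^sup>2 / m0)"
    using pos by (simp add: field_simps power2_eq_square)
  finally show ?thesis .
qed

end

section \<open>The range variance\<close>

theorem theorem3:
  fixes M :: "'a measure" and X :: "'a \<Rightarrow> real"
    and N :: "'b measure" and Y :: "'b \<Rightarrow> real"
    and N' :: "'c measure" and Y' :: "'c \<Rightarrow> real"
    and g :: "real \<Rightarrow> ennreal"
    and \<mu> \<sigma> p q :: real
  assumes "elliptical M X \<mu> \<sigma> g"
    and "\<sigma> > 0"
    and "generator_integral g < \<infinity>"
    and "generator_integral (cumulative_generator g) < \<infinity>"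
    and "generator_integral (cumulative_generator (cumulative_generator g)) < \<infinity>"
    and "0 < p" "p < q" "q < 1"
    and "elliptical N Y 0 1 g"
    and "elliptical N' Y' 0 1 (cumulative_generator g)"
  shows "let
      G = (\<lambda>u. enn2real (cumulative_generator g u));
      c = normalizing_constant g;
      c' = normalizing_constant (cumulative_generator g);
      \<eta>p = (VaR M X p - \<mu>) / \<sigma>;
      \<eta>q = (VaR M X q - \<mu>) / \<sigma>;
      lam = c * (\<eta>p * G (1/2 * \<eta>p\<^sup>2) - \<eta>q * G (1/2 * \<eta>q\<^sup>2));
      \<delta> = c * (G (1/2 * \<eta>p\<^sup>2) - G (1/2 * \<eta>q\<^sup>2));
      FY = F_interval N Y \<eta>p \<eta>q;
      FY' = F_interval N' Y' \<eta>p \<eta>q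
    in RV M X p q = \<sigma>\<^sup>2 / FY * (lam + c / c' * FY' - \<delta>\<^sup>2 / FY)"
proof -
  note X = assms(1) and VaR = assms(6-8) and Y = assms(9) and Y' = assms(10)
  define G where "G = (\<lambda>u. enn2real (cumulative_generator g u))"
  define c where "c = normalizing_constant g"
  define c' where "c' = normalizing_constant (cumulative_generator g)"
  define a where "a = (VaR M X p - \<mu>) / \<sigma>"
  define b where "b = (VaR M X q - \<mu>) / \<sigma>"
  define \<gamma> where "\<gamma> = (\<lambda>v. enn2real (g v))"
  let ?f = "standard_density g"
  have "a \<le> b"
    using VaR_strict_mono[OF X VaR] assms(2) by (simp add: a_def b_def divide_right_mono)
  \<comment> \<open>Finiteness of the cumulative generator at \<open>0\<close> comes from its being a density generator for \<open>Y'\<close>.\<close>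
  have gen: "density_generator g" "cumulative_generator g 0 < \<infinity>"
    using X Y' by (auto simp: elliptical_def density_generator_def)
  have \<gamma>: "set_integrable lborel {0..} \<gamma>"
    using generator_integrable(1)[OF gen] by (simp add: \<gamma>_def)
  have tail: "tail_integral \<gamma> (z\<^sup>2 / 2) = G (z\<^sup>2 / 2)" for z
    using generator_integrable(2)[OF gen] by (simp add: \<gamma>_def G_def)
  have f: "?f z = c * \<gamma> (z\<^sup>2 / 2)" for z
    by (simp add: standard_density_def c_def \<gamma>_def)
  have "(LBINT z:{a..b}. z * ?f z) = c * (LBINT z:{a..b}. z * \<gamma> (z\<^sup>2 / 2))"
    unfolding f by (simp flip: set_integral_mult_right add: mult_ac)
  also have "\<dots> = c * (G (a\<^sup>2 / 2) - G (b\<^sup>2 / 2))"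
    by (simp add: radial_first_moment[OF \<gamma> \<open>a \<le> b\<close>] tail)
  finally have m1: "(LBINT z:{a..b}. z * ?f z) = c * (G (a\<^sup>2 / 2) - G (b\<^sup>2 / 2))" .
  \<comment> \<open>The density of \<open>Y'\<close> is \<open>c' * G (z\<^sup>2/2)\<close>, so the integral left over in the second moment is a probability divided by \<open>c'\<close>.\<close>
  have "c' * (LBINT z:{a..b}. G (z\<^sup>2 / 2)) = F_interval N' Y' a b"
    unfolding F_interval_elliptical[OF Y' \<open>a \<le> b\<close>]
    by (simp add: standard_density_def[abs_def] c'_def G_def)
  then have FY': "(LBINT z:{a..b}. G (z\<^sup>2 / 2)) = F_interval N' Y' a b / c'"
    using normalizing_constant_nonzero[OF Y'] by (simp add: c'_def field_simps)
  have "(LBINT z:{a..b}. z\<^sup>2 * ?f z) = c * (LBINT z:{a..b}. z\<^sup>2 * \<gamma> (z\<^sup>2 / 2))"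
    unfolding f by (simp flip: set_integral_mult_right add: mult_ac)
  also have "\<dots> = c * (a * G (a\<^sup>2 / 2) - b * G (b\<^sup>2 / 2)) + c / c' * F_interval N' Y' a b"
    by (simp add: radial_second_moment[OF \<gamma> \<open>a \<le> b\<close>] tail FY' algebra_simps)
  finally have m2: "(LBINT z:{a..b}. z\<^sup>2 * ?f z) =
      c * (a * G (a\<^sup>2 / 2) - b * G (b\<^sup>2 / 2)) + c / c' * F_interval N' Y' a b" .
  have int1: "set_integrable lborel {a..b} (\<lambda>z. z * ?f z)"
    using set_integrable_mult_right[OF radial_first_moment_integrable[OF \<gamma>, of a b], of c]
    by (simp add: f mult_ac)
  have int2: "set_integrable lborel {a..b} (\<lambda>z. z\<^sup>2 * ?f z)"
    using set_integrable_mult_right[OF radial_second_moment_integrable[OF \<gamma>, of a b], of c]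
    by (simp add: f mult_ac)
  have "RV M X p q = \<sigma>\<^sup>2 / F_interval N Y a b *
      (c * (a * G (a\<^sup>2 / 2) - b * G (b\<^sup>2 / 2)) + c / c' * F_interval N' Y' a b
        - (c * (G (a\<^sup>2 / 2) - G (b\<^sup>2 / 2)))\<^sup>2 / F_interval N Y a b)"
    using RV_eq_truncated_moments[OF X VaR, folded a_def b_def, OF int1 int2]
    unfolding m1 m2 F_interval_elliptical[OF Y \<open>a \<le> b\<close>] .
  then show ?thesis
    by (simp add: Let_def G_def c_def c'_def a_def b_def)
qed

end
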